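(* Let $\mathcal{H}$ be a real Hilbert space, $T:\mathcal{H}\rightrightarrows\mathcal{H}$ maximal monotone with $T^{-1}(0)\neq\emptyset$, and let $z^*\in T^{-1}(0)$. Let $\delta>0$ and let $\{z^k\}$ be any sequence generated by the Halpern accelerated inexact proximal point algorithm (described in the context) with constant parameter $c_k\equiv c>0$ under criterion (A) with tolerances $$\varepsilon_k=\frac{1}{(k+2)^{1+\delta}},\quad k=0,1,\ldots .$$ Put $\beta_0=\sum_{k=0}^\infty\frac{1}{(k+2)^{1+\delta}}$ and $\kappa_0=2(\beta_0+\|z^0-z^*\|)$. Then for $k=1,2,\ldots$ $$\|z^k-P_c(z^k)\|\le\frac{2\|z^0-z^*\|}{k+1}+\sqrt{\Theta_k},$$ where: (i) if $0<\delta<1$, $$\Theta_k=\frac{8\kappa_0\beta_0}{(k+1)^2}+\frac{4\kappa_0}{(k+1)^{2+\delta}}+\frac{4\kappa_0(3-\delta)}{1-\delta}\frac{1}{(k+1)^{1+\delta}}+\frac{8\kappa_0}{2-\delta}\frac{1}{(k+1)^{\delta}};$$ (ii) if $\delta=1$, $$\Theta_k=\frac{4\kappa_0(1+2\beta_0)}{(k+1)^2}+\frac{4\kappa_0}{(k+1)^{3}}+8\kappa_0\frac{\ln(k+1)}{(k+1)^2}+\frac{8\kappa_0}{k+1};$$ (iii) if $1<\delta<2$, $$\Theta_k=8\kappa_0\Big(\frac{1}{\delta-1}+\beta_0\Big)\frac{1}{(k+1)^2}+\frac{4\kappa_0}{(k+1)^{2+\delta}}+\frac{4\kappa_0}{(k+1)^{1+\delta}}+\frac{8\kappa_0}{2-\delta}\frac{1}{(k+1)^{\delta}};$$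 (iv) if $\delta=2$, $$\Theta_k=\frac{8\kappa_0(1+\beta_0)}{(k+1)^2}+\frac{4\kappa_0}{(k+1)^{4}}+\frac{4\kappa_0}{(k+1)^{3}}+8\kappa_0\frac{\ln(k+1)}{(k+1)^2};$$ (v) if $\delta>2$, $$\Theta_k=8\kappa_0\Big(\frac{1}{\delta-1}+\frac{1}{\delta-2}+\beta_0\Big)\frac{1}{(k+1)^2}+\frac{4\kappa_0}{(k+1)^{2+\delta}}+\frac{4\kappa_0}{(k+1)^{1+\delta}}.$$
   Context: For $c>0$, $P_c=(I+cT)^{-1}$ is the (single-valued, everywhere defined) proximal mapping of $T$. $T^{-1}(0)=\{z\in\mathcal{H}:0\in T(z)\}$. Halpern accelerated inexact proximal point algorithm: choose $z^0\in\mathcal{H}$ and a sequence of parameters $c_k>0$; for $k=0,1,2,\ldots$ compute $\bar z^k\approx P_{c_k}(z^k)$ according to an inexactness criterion, and set $$z^{k+1}=\frac{1}{k+2}z^0+\frac{k+1}{k+2}\bar z^k .$$ Criterion (A): $\|\bar z^k-P_{c_k}(z^k)\|\le\varepsilon_k$ for all $k\ge 0$, where $\varepsilon_k\ge 0$ and $\sum_{k=0}^\infty\varepsilon_k<+\infty$. *)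

theory Defs
  imports "HOL-Analysis.Analysis"
begin

text \<open>
  A set-valued operator on \<open>H\<close> is a function \<open>'a \<Rightarrow> 'a set\<close>. Real Hilbert spaces are the types
  of sort \<open>{real_inner, complete_space}\<close>; no dimension or separability condition is implied.
\<close>

definition monotone_operator :: "('a::real_inner \<Rightarrow> 'a set) \<Rightarrow> bool" where
  "monotone_operator T \<longleftrightarrow>
     (\<forall>x y. \<forall>u\<in>T x. \<forall>v\<in>T y. inner (x - y) (u - v) \<ge> 0)"

definition maximal_monotone :: "('a::real_inner \<Rightarrow> 'a set) \<Rightarrow> bool" where
  "maximal_monotone T \<longleftrightarrow>
     monotone_operator T \<and>
     (\<forall>S. monotone_operator S \<and> (\<forall>x. T x \<subseteq> S x) \<longrightarrow> S = T)"

definition zeros :: "('a::real_inner \<Rightarrow> 'a set) \<Rightarrow> 'a set" where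
  "zeros T = {z. 0 \<in> T z}"

definition resolvent :: "real \<Rightarrow> ('a::real_inner \<Rightarrow> 'a set) \<Rightarrow> 'a \<Rightarrow> 'a set" where
  "resolvent c T z = {w. \<exists>v\<in>T w. z = w + c *\<^sub>R v}"

text \<open>
  The description operator is meaningful for maximal monotone \<open>T\<close> on a Hilbert space and
  \<open>c > 0\<close>: then every \<open>resolvent c T z\<close> is a singleton (Minty's theorem).
\<close>

definition prox :: "real \<Rightarrow> ('a::real_inner \<Rightarrow> 'a set) \<Rightarrow> 'a \<Rightarrow> 'a" where
  "prox c T z = (THE w. w \<in> resolvent c T z)"

definition criterion_A ::
  "('a::real_inner \<Rightarrow> 'a set) \<Rightarrow> (nat \<Rightarrow> real) \<Rightarrow> (nat \<Rightarrow> real) \<Rightarrow> (nat \<Rightarrow> 'a) \<Rightarrow> (nat \<Rightarrow> 'a) \<Rightarrow> bool"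
where
  "criterion_A T c \<epsilon> z zbar \<longleftrightarrow>
     (\<forall>k. 0 \<le> \<epsilon> k) \<and> summable \<epsilon> \<and>
     (\<forall>k. norm (zbar k - prox (c k) T (z k)) \<le> \<epsilon> k)"

text \<open>\<open>z\<close> is a run of the Halpern accelerated inexact proximal point algorithm under criterion (A).\<close>

definition halpern_ippa ::
  "('a::real_inner \<Rightarrow> 'a set) \<Rightarrow> (nat \<Rightarrow> real) \<Rightarrow> (nat \<Rightarrow> real) \<Rightarrow> (nat \<Rightarrow> 'a) \<Rightarrow> bool"
where
  "halpern_ippa T c \<epsilon> z \<longleftrightarrow>
     (\<forall>k. 0 < c k) \<and>
     (\<exists>zbar. criterion_A T c \<epsilon> z zbar \<and>
        (\<forall>k. z (Suc k) =
           (1 / (real k + 2)) *\<^sub>R z 0 + ((real k + 1) / (real k + 2)) *\<^sub>R zbar k))"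

end

theory Submission
  imports Defs
begin

text \<open>By Minty's theorem the proximal mapping is everywhere defined and nonexpansive. For a
  nonexpansive \<open>P\<close>, the residual \<open>Q x = x - P x\<close> is \<open>1/2\<close>-cocoercive, so along the exact Halpern
  iteration \<open>k (k + 1) / 2 * (norm (Q (z k)))\<^sup>2 + (k + 1) * inner (Q (z k)) (z k - z 0)\<close> does not increase;
  with errors it grows by at most \<open>\<kappa>0 (k + 1) (2 k + 3) \<epsilon> k\<close>. Bounding it below by
  cocoercivity at \<open>zstar\<close> gives a quadratic inequality for \<open>(k + 1) * norm (Q (z k))\<close>, and the rates
  come from \<open>(k + 1) (2 k + 3) \<epsilon> k \<le> 2 (k + 2) powr (1 - \<delta>)\<close>, summed by comparison with an integral.\<close>

section \<open>Maximal monotonicity and Minty's theorem\<close>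

text \<open>Adding the pair \<open>(x, u)\<close> to the graph keeps it monotone, so by maximality
  the enlarged operator is \<open>T\<close> itself.\<close>

lemma maximal_monotoneD:
  assumes "maximal_monotone T" and "\<And>y v. v \<in> T y \<Longrightarrow> inner (x - y) (u - v) \<ge> 0"
  shows "u \<in> T x"
proof -
  define S where "S = T(x := insert u (T x))"
  have T: "inner (a - b) (f - g) \<ge> 0" if "f \<in> T a" "g \<in> T b" for a b f g
    using assms(1) that unfolding maximal_monotone_def monotone_operator_def by blast
  have sym: "inner (y - x) (v - u) \<ge> 0" if "v \<in> T y" for y v
    using assms(2)[OF that] by (metis inner_minus_left inner_minus_right minus_diff_eq minus_minus)
  have "monotone_operator S"
    unfolding monotone_operator_def S_def
    using T assms(2) sym by (auto split: if_splits)
  moreover have "\<forall>y. T y \<subseteq> S y"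
    by (auto simp: S_def)
  ultimately have "S = T"
    using assms(1) unfolding maximal_monotone_def by blast
  then show ?thesis
    by (metis S_def fun_upd_same insertI1)
qed

text \<open>A pointwise supremum of affine functions plus half the squared norm is strongly convex, so
  minimising sequences are Cauchy. The supremum may be infinite, hence sublevel sets.\<close>

lemma strongly_convex_sup_attains_min:
  fixes l :: "'i \<Rightarrow> 'b::{real_inner, complete_space}" and b :: "'i \<Rightarrow> real" and I :: "'i set"
  defines "S \<equiv> \<lambda>t. {w. \<forall>i\<in>I. inner (l i) w + b i + (norm w)\<^sup>2 / 2 \<le> t}"
  assumes ne: "S t0 \<noteq> {}" and lower: "\<And>t. S t \<noteq> {} \<Longrightarrow> L \<le> t"
  shows "\<exists>m. S m \<noteq> {} \<and> (\<forall>t. S t \<noteq> {} \<longrightarrow> m \<le> t)"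
proof -
  define m where "m = Inf {t. S t \<noteq> {}}"
  have bdd: "bdd_below {t. S t \<noteq> {}}"
    using lower by (auto intro!: bdd_belowI)
  have m_le: "m \<le> t" if "S t \<noteq> {}" for t
    unfolding m_def using bdd that by (auto intro: cInf_lower)
  have S_mono: "S s \<subseteq> S t" if "s \<le> t" for s t
    using that by (force simp: S_def)
  have ex: "\<exists>w. w \<in> S (m + 1 / real (Suc n))" for n
  proof -
    have "Inf {t. S t \<noteq> {}} < m + 1 / real (Suc n)"
      by (simp add: m_def)
    then obtain t where "S t \<noteq> {}" "t < m + 1 / real (Suc n)"
      using ne by (subst (asm) cInf_less_iff[OF _ bdd]) auto
    then show ?thesis using S_mono[of t "m + 1 / real (Suc n)"] by auto
  qed
  then obtain w where w: "\<And>n. w n \<in> S (m + 1 / real (Suc n))"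
    by metis
  \<comment> \<open>At the midpoint the affine parts average exactly, while half the squared norm
    falls an eighth of \<open>(norm (x - y))\<^sup>2\<close> below its average; no nonempty sublevel
    set lies below \<open>m\<close>.\<close>
  have mid: "(norm (x - y))\<^sup>2 \<le> 8 * (t - m)" if "x \<in> S t" "y \<in> S t" for x y t
  proof -
    have par: "(norm ((1/2) *\<^sub>R (x + y)))\<^sup>2 = ((norm x)\<^sup>2 + (norm y)\<^sup>2) / 2 - (norm (x - y))\<^sup>2 / 4"
      by (simp add: power2_norm_eq_inner inner_add_left inner_add_right inner_diff_left inner_diff_right
          inner_commute field_simps)
    have "(1/2) *\<^sub>R (x + y) \<in> S (t - (norm (x - y))\<^sup>2 / 8)"
      unfolding S_def
    proof (intro CollectI ballI)
      fix i assume "i \<in> I"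
      then have "inner (l i) x + b i + (norm x)\<^sup>2 / 2 \<le> t" "inner (l i) y + b i + (norm y)\<^sup>2 / 2 \<le> t"
        using that by (auto simp: S_def)
      moreover have "inner (l i) ((1/2) *\<^sub>R (x + y)) = (inner (l i) x + inner (l i) y) / 2"
        by (simp add: inner_add_right)
      ultimately show "inner (l i) ((1/2) *\<^sub>R (x + y)) + b i + (norm ((1/2) *\<^sub>R (x + y)))\<^sup>2 / 2
          \<le> t - (norm (x - y))\<^sup>2 / 8"
        using par by (simp add: field_simps)
    qed
    then have "m \<le> t - (norm (x - y))\<^sup>2 / 8"
      using m_le by blast
    then show ?thesis by simp
  qed
  have "Cauchy w"
  proof (rule metric_CauchyI)
    fix e :: real assume "e > 0"
    then obtain N where N: "8 / e\<^sup>2 < real N"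
      using reals_Archimedean2 by blast
    have "dist (w i) (w j) < e" if "i \<ge> N" "j \<ge> N" for i j
    proof -
      have "w i \<in> S (m + 1 / real (Suc N))" "w j \<in> S (m + 1 / real (Suc N))"
        using that w S_mono by (meson add_left_mono divide_left_mono le_numeral_extra(4) of_nat_mono
            Suc_le_mono frac_le of_nat_0_less_iff zero_less_Suc zero_le_one subsetD)+
      then have "(norm (w i - w j))\<^sup>2 \<le> 8 / real (Suc N)"
        using mid by fastforce
      also have "\<dots> < e\<^sup>2"
        using N \<open>e > 0\<close> by (simp add: field_simps) (smt (verit) zero_less_power)
      finally show ?thesis
        using \<open>e > 0\<close> by (simp add: dist_norm power_less_imp_less_base)
    qed
    then show "\<exists>N. \<forall>i\<ge>N. \<forall>j\<ge>N. dist (w i) (w j) < e" by blast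
  qed
  then obtain w0 where lim: "w \<longlonglongrightarrow> w0"
    using Cauchy_convergent convergent_def by blast
  \<comment> \<open>Each inequality defining the sublevel sets is continuous in the point, so it
    passes to the limit one index at a time.\<close>
  have "w0 \<in> S m"
    unfolding S_def
  proof (intro CollectI ballI)
    fix i assume i: "i \<in> I"
    have "(\<lambda>n. inner (l i) (w n) + b i + (norm (w n))\<^sup>2 / 2)
        \<longlonglongrightarrow> inner (l i) w0 + b i + (norm w0)\<^sup>2 / 2"
      by (intro tendsto_intros lim) simp
    moreover have "(\<lambda>n. m + 1 / real (Suc n)) \<longlonglongrightarrow> m + 0"
      by (intro tendsto_intros LIMSEQ_Suc lim_1_over_n)
    moreover have "inner (l i) (w n) + b i + (norm (w n))\<^sup>2 / 2 \<le> m + 1 / real (Suc n)" for n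
      using w[of n] i unfolding S_def by blast
    ultimately show "inner (l i) w0 + b i + (norm w0)\<^sup>2 / 2 \<le> m"
      by (metis (no_types, lifting) LIMSEQ_le add.right_neutral)
  qed
  with m_le show ?thesis by blast
qed

text \<open>The minimiser \<open>(x, u)\<close> of the Fitzpatrick function plus half the squared norm satisfies
  \<open>- x \<in> T x\<close>: its optimality condition makes \<open>(- u, - x)\<close> monotonically related to the graph,
  with a margin \<open>(norm (x + u))\<^sup>2\<close> that must vanish.\<close>

lemma minty_at_zero:
  fixes T :: "'a::{real_inner, complete_space} \<Rightarrow> 'a set"
  assumes mon: "\<And>x y u v. u \<in> T x \<Longrightarrow> v \<in> T y \<Longrightarrow> inner (x - y) (u - v) \<ge> 0"
    and max: "\<And>x u. (\<And>y v. v \<in> T y \<Longrightarrow> inner (x - y) (u - v) \<ge> 0) \<Longrightarrow> u \<in> T x"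
  shows "\<exists>x. - x \<in> T x"
proof -
  define G where "G = {(y, v). v \<in> T y}"
  \<comment> \<open>For \<open>w = (x, u)\<close> and \<open>i = (y, v)\<close> the affine part is
    \<open>inner x v + inner y u - inner y v\<close>; its supremum over the graph is the Fitzpatrick
    function at \<open>(x, u)\<close>.\<close>
  define S where "S t = {w. \<forall>i\<in>G. inner (prod.swap i) w + - inner (fst i) (snd i)
    + (norm w)\<^sup>2 / 2 \<le> t}" for t
  \<comment> \<open>The Fitzpatrick function dominates \<open>inner x u\<close>: on the graph the
    pair itself is a witness, off it maximality supplies one.\<close>
  have fitz: "\<exists>(y, v)\<in>G. inner x u \<le> inner x v + inner y u - inner y v" for x u
  proof (cases "u \<in> T x")
    case True
    then show ?thesis by (intro bexI[of _ "(x, u)"]) (auto simp: G_def)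
  next
    case False
    then obtain y v where "v \<in> T y" "inner (x - y) (u - v) < 0"
      using max by (meson not_less)
    then show ?thesis
      by (intro bexI[of _ "(y, v)"]) (auto simp: G_def inner_diff_left inner_diff_right)
  qed
  \<comment> \<open>Conversely, by monotonicity it is at most \<open>inner y v\<close> at graph
    points.\<close>
  have fitz_G: "inner y v' + inner y' v - inner y' v' \<le> inner y v" if "v \<in> T y" "v' \<in> T y'" for y v y' v'
    using mon[OF that] by (simp add: inner_diff_left inner_diff_right)
  have S_iff: "(x, u) \<in> S t \<longleftrightarrow> (\<forall>y v. v \<in> T y \<longrightarrow>
      inner x v + inner y u - inner y v + ((norm x)\<^sup>2 + (norm u)\<^sup>2) / 2 \<le> t)" for x u t
    by (auto simp: S_def G_def inner_commute norm_prod_def algebra_simps)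
  obtain y0 v0 where yv0: "v0 \<in> T y0"
    using fitz[of 0 0] by (auto simp: G_def)
  have ne: "S (inner y0 v0 + ((norm y0)\<^sup>2 + (norm v0)\<^sup>2) / 2) \<noteq> {}"
    using S_iff[of y0 v0] fitz_G[OF yv0] by fastforce
  have S_lower: "inner x u + ((norm x)\<^sup>2 + (norm u)\<^sup>2) / 2 \<le> t" if "(x, u) \<in> S t" for x u t
  proof -
    obtain y v where "v \<in> T y" "inner x u \<le> inner x v + inner y u - inner y v"
      using fitz[of x u] by (auto simp: G_def)
    then show ?thesis using that unfolding S_iff by fastforce
  qed
  have sq: "inner x u + ((norm x)\<^sup>2 + (norm u)\<^sup>2) / 2 = (norm (x + u))\<^sup>2 / 2" for x u :: 'a
    by (simp add: power2_norm_eq_inner inner_add_left inner_add_right inner_commute field_simps)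
  have S_nonneg: "0 \<le> t" if "S t \<noteq> {}" for t
    using that S_lower sq by (smt (verit) ex_in_conv surj_pair zero_le_power2 divide_nonneg_pos)
  have "\<exists>m. S m \<noteq> {} \<and> (\<forall>t. S t \<noteq> {} \<longrightarrow> m \<le> t)"
    using strongly_convex_sup_attains_min[where l = prod.swap and b = "\<lambda>i. - inner (fst i) (snd i)"
          and I = G, folded S_def, OF ne] S_nonneg by blast
  then obtain m w where wm: "w \<in> S m" and m_le: "\<And>t. S t \<noteq> {} \<Longrightarrow> m \<le> t"
    by blast
  obtain x u where w: "w = (x, u)" by fastforce
  define F where "F = m - ((norm x)\<^sup>2 + (norm u)\<^sup>2) / 2"
  have F_ge: "inner x u \<le> F"
    using S_lower wm unfolding w F_def by fastforce
  \<comment> \<open>First-order optimality along the segment from \<open>(x, u)\<close> to a graph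
    point \<open>(y, v)\<close>. By convexity the Fitzpatrick function there is at most
    \<open>(1 - s) * F + s * inner y v\<close>; a violation \<open>d\<close> would be of order
    \<open>s\<close>, against a quadratic remainder \<open>s\<^sup>2 / 2 * N\<close>.\<close>
  have opt: "F + (norm x)\<^sup>2 + (norm u)\<^sup>2 - inner x y - inner u v \<le> inner y v" if yv: "v \<in> T y" for y v
  proof (rule ccontr)
    define d where "d = F + (norm x)\<^sup>2 + (norm u)\<^sup>2 - inner x y - inner u v - inner y v"
    define N where "N = (norm (y - x))\<^sup>2 + (norm (v - u))\<^sup>2"
    assume "\<not> ?thesis"
    then have "d > 0" by (simp add: d_def)
    have key: "d \<le> s / 2 * N" if s: "0 < s" "s \<le> 1" for s
    proof -
      have n: "(norm (x + s *\<^sub>R (y - x)))\<^sup>2 = (norm x)\<^sup>2 + 2 * s * (inner x y - (norm x)\<^sup>2) + s\<^sup>2 * (norm (y - x))\<^sup>2"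
        for x y :: 'a
      proof -
        have "(norm (x + s *\<^sub>R a))\<^sup>2 = (norm x)\<^sup>2 + 2 * s * inner x a + s\<^sup>2 * (norm a)\<^sup>2" for a
          unfolding power2_norm_eq_inner
          by (simp add: inner_add_left inner_add_right inner_commute[of a x] power2_eq_square distrib_left)
        then show ?thesis
          by (simp add: inner_diff_right power2_norm_eq_inner)
      qed
      have "(x + s *\<^sub>R (y - x), u + s *\<^sub>R (v - u)) \<in> S ((1 - s) * F + s * inner y v
          + ((norm (x + s *\<^sub>R (y - x)))\<^sup>2 + (norm (u + s *\<^sub>R (v - u)))\<^sup>2) / 2)"
        unfolding S_iff
      proof (intro allI impI)
        fix y' v' assume yv': "v' \<in> T y'"
        have "inner x v' + inner y' u - inner y' v' \<le> F"
          using wm yv' unfolding w S_iff F_def by fastforce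
        then have 1: "(1 - s) * (inner x v' + inner y' u - inner y' v') \<le> (1 - s) * F"
          using s by (intro mult_left_mono) auto
        have 2: "s * (inner y v' + inner y' v - inner y' v') \<le> s * inner y v"
          using s fitz_G[OF yv yv'] by (intro mult_left_mono) auto
        have "inner (x + s *\<^sub>R (y - x)) v' + inner y' (u + s *\<^sub>R (v - u)) - inner y' v'
          = (1 - s) * (inner x v' + inner y' u - inner y' v') + s * (inner y v' + inner y' v - inner y' v')"
          by (simp add: inner_add_left inner_add_right inner_diff_left inner_diff_right algebra_simps)
        then show "inner (x + s *\<^sub>R (y - x)) v' + inner y' (u + s *\<^sub>R (v - u)) - inner y' v'
          + ((norm (x + s *\<^sub>R (y - x)))\<^sup>2 + (norm (u + s *\<^sub>R (v - u)))\<^sup>2) / 2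
          \<le> (1 - s) * F + s * inner y v
          + ((norm (x + s *\<^sub>R (y - x)))\<^sup>2 + (norm (u + s *\<^sub>R (v - u)))\<^sup>2) / 2"
          using 1 2 by linarith
      qed
      then have "m \<le> (1 - s) * F + s * inner y v
          + ((norm (x + s *\<^sub>R (y - x)))\<^sup>2 + (norm (u + s *\<^sub>R (v - u)))\<^sup>2) / 2"
        using m_le by blast
      then have "s * d \<le> s * (s / 2 * N)"
        
        unfolding n d_def N_def F_def
        by (simp add: algebra_simps add_divide_distrib diff_divide_distrib power2_eq_square[of s])
      then show ?thesis using s by simp
    qed
    have "N \<ge> 0" by (simp add: N_def)
    \<comment> \<open>Small enough that \<open>s / 2 * N < d\<close>; the \<open>+ 1\<close> covers
      \<open>N = 0\<close>.\<close>
    define s where "s = min 1 (d / (N + 1))"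
    have "0 < s" "s \<le> 1" "s \<le> d / (N + 1)"
      using \<open>d > 0\<close> \<open>N \<ge> 0\<close> by (auto simp: s_def)
    then have "s / 2 * N \<le> d / (N + 1) / 2 * N"
      using \<open>N \<ge> 0\<close> by (intro mult_right_mono divide_right_mono) auto
    also have "\<dots> = d * (N / (2 * (N + 1)))"
      by (simp add: mult.commute)
    also have "\<dots> < d * 1"
      using \<open>d > 0\<close> \<open>N \<ge> 0\<close> by (intro mult_strict_left_mono) auto
    finally show False using key[OF \<open>0 < s\<close> \<open>s \<le> 1\<close>] by simp
  qed
  have margin: "(norm (x + u))\<^sup>2 \<le> inner (- u - y) (- x - v)" if "v \<in> T y" for y v
  proof -
    have "(norm (x + u))\<^sup>2 = 2 * inner x u + (norm x)\<^sup>2 + (norm u)\<^sup>2"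
      using sq[of x u] by (simp add: field_simps)
    also have "\<dots> \<le> inner x u + inner u v + inner x y + inner y v"
      using opt[OF that] F_ge by linarith
    also have "\<dots> = inner (- u - y) (- x - v)"
      by (simp add: inner_diff_left inner_diff_right inner_commute)
    finally show ?thesis .
  qed
  have in_T: "- x \<in> T (- u)"
    by (rule max) (rule order_trans[OF zero_le_power2 margin])
  \<comment> \<open>The pair \<open>(- u, - x)\<close> now belongs to the graph, and the margin
    taken against that same pair has right-hand side 0.\<close>
  have "(norm (x + u))\<^sup>2 \<le> 0"
    using margin[OF in_T] by simp
  then have "norm (x + u) = 0" by simp
  then have "x + u = 0" by simp
  then have u: "- u = x" by (metis minus_unique minus_minus add.commute)
  show ?thesis using in_T unfolding u by blast
qed

text \<open>Reduces to the previous lemma for the rescaled and shifted operator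
  \<open>S x = c T x - z\<close>: the inclusion \<open>- x \<in> S x\<close> says exactly that
  \<open>z - x\<close> lies in \<open>c T x\<close>.\<close>

lemma minty:
  fixes T :: "'a::{real_inner, complete_space} \<Rightarrow> 'a set"
  assumes T: "maximal_monotone T" and c: "c > 0"
  shows "\<exists>w. w \<in> resolvent c T z"
proof -
  define S where "S = (\<lambda>x. (\<lambda>v. c *\<^sub>R v - z) ` T x)"
  have "\<exists>x. - x \<in> S x"
  proof (rule minty_at_zero)
    fix x y u v assume "u \<in> S x" "v \<in> S y"
    then obtain u' v' where *: "u = c *\<^sub>R u' - z" "v = c *\<^sub>R v' - z" "u' \<in> T x" "v' \<in> T y"
      by (auto simp: S_def)
    then have "inner (x - y) (u' - v') \<ge> 0"
      using T unfolding maximal_monotone_def monotone_operator_def by blast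
    moreover have "u - v = c *\<^sub>R (u' - v')"
      by (simp add: * scaleR_diff_right)
    ultimately show "inner (x - y) (u - v) \<ge> 0"
      using c by simp
  next
    fix x u assume *: "\<And>y v. v \<in> S y \<Longrightarrow> inner (x - y) (u - v) \<ge> 0"
    have "(1 / c) *\<^sub>R (u + z) \<in> T x"
    proof (rule maximal_monotoneD[OF T])
      fix y v assume "v \<in> T y"
      then have "inner (x - y) (u - (c *\<^sub>R v - z)) \<ge> 0"
        by (intro *) (auto simp: S_def)
      moreover have "u - (c *\<^sub>R v - z) = c *\<^sub>R ((1 / c) *\<^sub>R (u + z) - v)"
        using c by (simp add: scaleR_diff_right)
      ultimately show "inner (x - y) ((1 / c) *\<^sub>R (u + z) - v) \<ge> 0"
        using c by (simp add: zero_le_mult_iff)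
    qed
    then show "u \<in> S x"
      using c by (force simp: S_def)
  qed
  then show ?thesis
    by (force simp: S_def resolvent_def algebra_simps)
qed

section \<open>The proximal mapping\<close>

text \<open>In the expansion of the squared norm of
  \<open>z - z' = (w - w') + c *\<^sub>R (v - v')\<close> the cross term is nonnegative by
  monotonicity.\<close>

lemma resolvent_nonexpansive:
  assumes T: "monotone_operator T" and c: "c > 0"
    and w: "w \<in> resolvent c T z" and w': "w' \<in> resolvent c T z'"
  shows "norm (w - w') \<le> norm (z - z')"
proof -
  obtain v v' where v: "v \<in> T w" "z = w + c *\<^sub>R v" and v': "v' \<in> T w'" "z' = w' + c *\<^sub>R v'"
    using w w' by (auto simp: resolvent_def)
  have "inner (w - w') (v - v') \<ge> 0"
    using T v v' unfolding monotone_operator_def by blast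
  then have "0 \<le> 2 * c * inner (w - w') (v - v')"
    using c by simp
  moreover have "(norm (z - z'))\<^sup>2 = (norm (w - w'))\<^sup>2 + 2 * c * inner (w - w') (v - v')
      + (norm (c *\<^sub>R (v - v')))\<^sup>2"
  proof -
    have "z - z' = (w - w') + c *\<^sub>R (v - v')"
      by (simp add: v v' algebra_simps)
    then show ?thesis
      using dot_norm[of "w - w'" "c *\<^sub>R (v - v')"] by (simp del: norm_scaleR)
  qed
  moreover have "(norm (c *\<^sub>R (v - v')))\<^sup>2 \<ge> 0"
    by (rule zero_le_power2)
  ultimately have "(norm (w - w'))\<^sup>2 \<le> (norm (z - z'))\<^sup>2"
    by linarith
  then show ?thesis
    by (rule power2_le_imp_le) simp
qed

text \<open>Nonexpansiveness with equal arguments gives the uniqueness that \<open>THE\<close>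
  requires.\<close>

lemma prox_eqI:
  assumes "monotone_operator T" "c > 0" "w \<in> resolvent c T z"
  shows "prox c T z = w"
  unfolding prox_def
proof (rule the_equality)
  show "w' = w" if "w' \<in> resolvent c T z" for w'
    using resolvent_nonexpansive[OF assms(1,2) that assms(3)] by simp
qed fact

lemma prox_in_resolvent:
  fixes T :: "'a::{real_inner, complete_space} \<Rightarrow> 'a set"
  assumes "maximal_monotone T" "c > 0"
  shows "prox c T z \<in> resolvent c T z"
proof -
  have mon: "monotone_operator T"
    using assms(1) by (simp add: maximal_monotone_def)
  obtain w where w: "w \<in> resolvent c T z"
    using minty[OF assms] by blast
  then show ?thesis
    by (simp add: prox_eqI[OF mon assms(2) w])
qed

lemma prox_zero:
  assumes "monotone_operator T" "c > 0" "p \<in> zeros T"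
  shows "prox c T p = p"
  using assms by (intro prox_eqI) (auto simp: zeros_def resolvent_def intro!: bexI[of _ 0])

section \<open>Halpern iteration of a nonexpansive map with errors\<close>

text \<open>Completes the square and splits the root by subadditivity; applied to
  \<open>X = (real k + 1) * norm (Q k)\<close>.\<close>

lemma le_of_quadratic:
  fixes X d R :: real
  assumes "X\<^sup>2 / 2 - d * X \<le> R" "d \<ge> 0" "R \<ge> 0"
  shows "X \<le> 2 * d + sqrt (2 * R)"
proof -
  have "(X - d)\<^sup>2 \<le> d\<^sup>2 + 2 * R"
    using assms by (simp add: power2_eq_square algebra_simps)
  then have "X - d \<le> sqrt (d\<^sup>2 + 2 * R)"
    using real_le_rsqrt by blast
  also have "\<dots> \<le> sqrt (d\<^sup>2) + sqrt (2 * R)"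
    using assms by (intro sqrt_add_le_add_sqrt) auto
  finally show ?thesis using assms by simp
qed

lemma halpern_residual_bound:
  fixes P :: "'a::real_inner \<Rightarrow> 'a" and z zbar :: "nat \<Rightarrow> 'a" and p :: 'a
  defines "d \<equiv> norm (z 0 - p)"
  assumes P: "\<And>x y. norm (P x - P y) \<le> norm (x - y)" and p: "P p = p"
    and err: "\<And>k. norm (zbar k - P (z k)) \<le> \<epsilon> k"
    and step: "\<And>k. z (Suc k) = (1 / (real k + 2)) *\<^sub>R z 0 + ((real k + 1) / (real k + 2)) *\<^sub>R zbar k"
    and B: "\<And>n. sum \<epsilon> {..<n} \<le> B"
  shows "norm (z k - P (z k)) \<le> (2 * d
    + sqrt (4 * (B + d) * (\<Sum>j<k. (real j + 1) * (2 * real j + 3) * \<epsilon> j))) / (real k + 1)"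
proof -
  define Q where "Q = (\<lambda>k. z k - P (z k))"
  define e where "e = (\<lambda>k. zbar k - P (z k))"
  \<comment> \<open>The potential from the overview. It vanishes at \<open>k = 0\<close>, so bounds
    on its increments add up to a bound on \<open>E k\<close>.\<close>
  define E where "E = (\<lambda>k. real k * (real k + 1) / 2 * (norm (Q k))\<^sup>2 + (real k + 1) * inner (Q k) (z k - z 0))"
  have e: "norm (e k) \<le> \<epsilon> k" for k
    using err by (simp add: e_def)
  have eps: "\<epsilon> k \<ge> 0" for k
    using e[of k] norm_ge_zero order_trans by blast
  \<comment> \<open>Nonexpansiveness, rewritten by expanding \<open>P x - P y\<close> as
    \<open>x - y\<close> minus the difference of the residuals.\<close>
  have cocoercive: "(norm ((x - P x) - (y - P y)))\<^sup>2 / 2 \<le> inner ((x - P x) - (y - P y)) (x - y)" for x y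
  proof -
    have "(norm (P x - P y))\<^sup>2 \<le> (norm (x - y))\<^sup>2"
      using P by (simp add: power_mono)
    moreover have "(norm (P x - P y))\<^sup>2 = (norm (x - y))\<^sup>2
        - 2 * inner ((x - P x) - (y - P y)) (x - y) + (norm ((x - P x) - (y - P y)))\<^sup>2"
      by (simp add: power2_norm_eq_inner inner_add_left inner_add_right inner_diff_left inner_diff_right
          inner_commute algebra_simps)
    ultimately show ?thesis by simp
  qed
  \<comment> \<open>The factor \<open>real k + 1\<close> clears the Halpern denominators, so each
    step adds just \<open>d\<close> and one weighted error.\<close>
  have dist: "(real k + 1) * norm (z k - p) \<le> (real k + 1) * d + (\<Sum>j<k. (real j + 1) * \<epsilon> j)" for k
  proof (induction k)
    case 0
    then show ?case by (simp add: d_def)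
  next
    case (Suc k)
    have "(real k + 2) *\<^sub>R (z (Suc k) - p) = (z 0 - p) + (real k + 1) *\<^sub>R ((P (z k) - P p) + e k)"
    proof -
      have "(real k + 2) *\<^sub>R z (Suc k) = z 0 + (real k + 1) *\<^sub>R zbar k"
        by (simp add: step scaleR_add_right)
      then show ?thesis
        by (simp add: e_def p scaleR_2 algebra_simps)
    qed
    then have "(real k + 2) * norm (z (Suc k) - p) = norm ((z 0 - p) + (real k + 1) *\<^sub>R ((P (z k) - P p) + e k))"
      by (metis norm_scaleR abs_of_nonneg add_nonneg_nonneg of_nat_0_le_iff zero_le_numeral)
    also have "\<dots> \<le> d + (real k + 1) * (norm (z k - p) + \<epsilon> k)"
    proof -
      have "norm ((P (z k) - P p) + e k) \<le> norm (z k - p) + \<epsilon> k"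
        using P e by (meson add_mono norm_triangle_le)
      then have "norm ((real k + 1) *\<^sub>R ((P (z k) - P p) + e k)) \<le> (real k + 1) * (norm (z k - p) + \<epsilon> k)"
        by (simp add: mult_left_mono)
      then show ?thesis
        unfolding d_def by (meson add_left_mono norm_triangle_ineq order_trans)
    qed
    finally show ?case
      using Suc.IH by (simp add: algebra_simps)
  qed
  \<comment> \<open>Bounding the weights \<open>real j + 1\<close> by \<open>real k + 1\<close>
    gives \<open>norm (z k - p) \<le> B + d\<close>; the residual costs a factor 2. With
    \<open>B = \<beta>0\<close> this is \<open>\<kappa>0\<close>.\<close>
  have Q: "norm (Q k) \<le> 2 * (B + d)" for k
  proof -
    have "(\<Sum>j<k. (real j + 1) * \<epsilon> j) \<le> (\<Sum>j<k. (real k + 1) * \<epsilon> j)"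
      using eps by (intro sum_mono mult_right_mono) auto
    also have "\<dots> \<le> (real k + 1) * B"
      using B by (simp add: sum_distrib_left[symmetric])
    finally have "(real k + 1) * norm (z k - p) \<le> (real k + 1) * (B + d)"
      using dist[of k] by (simp add: algebra_simps)
    then have "norm (z k - p) \<le> B + d"
      by simp
    moreover have "norm (Q k) \<le> norm (z k - p) + norm (P (z k) - P p)"
      unfolding Q_def p by (metis diff_diff_eq2 diff_add_cancel norm_triangle_ineq4 add_diff_cancel_right')
    ultimately show ?thesis
      using P[of "z k" p] by simp
  qed
  have E_step: "E (Suc k) \<le> E k + 2 * (B + d) * ((real k + 1) * (2 * real k + 3) * \<epsilon> k)" for k
  proof -
    define n where "n = real k + 1"
    have n: "n \<ge> 1" by (simp add: n_def)
    define a b where "a = z k - z 0" and "b = z (Suc k) - z 0"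
    \<comment> \<open>The Halpern step seen from the anchor \<open>z 0\<close>. Below it eliminates
      \<open>a\<close> from the product with \<open>Q (Suc k)\<close> and \<open>b\<close> from the
      product with \<open>Q k\<close>.\<close>
    have nb: "(n + 1) *\<^sub>R b = n *\<^sub>R (a - Q k + e k)"
    proof -
      have "(n + 1) *\<^sub>R z (Suc k) = z 0 + n *\<^sub>R zbar k"
        by (simp add: step n_def scaleR_add_right add.commute)
      then show ?thesis
        by (simp add: a_def b_def Q_def e_def algebra_simps)
    qed
    have nb': "(n + 1) * inner x b = n * (inner x a - inner x (Q k) + inner x (e k))" for x
      using arg_cong[OF nb, of "inner x"] by (simp add: inner_add_right inner_diff_right)
    have "(norm (Q (Suc k) - Q k))\<^sup>2 / 2 \<le> inner (Q (Suc k) - Q k) (b - a)"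
      using cocoercive[of "z (Suc k)" "z k"] by (simp add: Q_def a_def b_def)
    then have "(inner (Q (Suc k)) (Q (Suc k)) + inner (Q k) (Q k)) / 2 - inner (Q (Suc k)) (Q k)
      \<le> inner (Q (Suc k)) b - inner (Q k) b - inner (Q (Suc k)) a + inner (Q k) a"
      by (simp add: power2_norm_eq_inner inner_diff_left inner_diff_right inner_commute field_simps)
    \<comment> \<open>With this factor the terms in \<open>inner (Q (Suc k)) (Q k)\<close> on the
      two sides cancel after the elimination.\<close>
    then have "n * (n + 1) * ((inner (Q (Suc k)) (Q (Suc k)) + inner (Q k) (Q k)) / 2 - inner (Q (Suc k)) (Q k))
      \<le> n * (n + 1) * (inner (Q (Suc k)) b - inner (Q k) b - inner (Q (Suc k)) a + inner (Q k) a)"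
      using n by (intro mult_left_mono) auto
    also have "\<dots> = n * ((n + 1) * inner (Q (Suc k)) b) - n * ((n + 1) * inner (Q k) b)
      - (n + 1) * (n * inner (Q (Suc k)) a) + n * (n + 1) * inner (Q k) a"
      by (simp add: algebra_simps)
    also have "n * inner (Q (Suc k)) a = (n + 1) * inner (Q (Suc k)) b + n * inner (Q (Suc k)) (Q k) - n * inner (Q (Suc k)) (e k)"
      using nb'[of "Q (Suc k)"] by (simp add: algebra_simps)
    also have "(n + 1) * inner (Q k) b = n * (inner (Q k) a - inner (Q k) (Q k) + inner (Q k) (e k))"
      by (rule nb')
    finally have "(n + 1) * n / 2 * inner (Q (Suc k)) (Q (Suc k)) + (n + 1) * inner (Q (Suc k)) b
      \<le> n * (n - 1) / 2 * inner (Q k) (Q k) + n * inner (Q k) a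
        + n * (n + 1) * inner (Q (Suc k)) (e k) - n * n * inner (Q k) (e k)"
      by (simp add: field_simps)
    moreover have "inner (Q (Suc k)) (e k) \<le> 2 * (B + d) * \<epsilon> k" "- inner (Q k) (e k) \<le> 2 * (B + d) * \<epsilon> k"
    proof -
      have "\<bar>inner (Q j) (e k)\<bar> \<le> 2 * (B + d) * \<epsilon> k" for j
        by (rule order_trans[OF Cauchy_Schwarz_ineq2 mult_mono])
          (use Q e order_trans[OF norm_ge_zero Q] in auto)
      from this[of k] this[of "Suc k"]
      show "inner (Q (Suc k)) (e k) \<le> 2 * (B + d) * \<epsilon> k" "- inner (Q k) (e k) \<le> 2 * (B + d) * \<epsilon> k"
        by linarith+
    qed
    then have "n * (n + 1) * inner (Q (Suc k)) (e k) \<le> n * (n + 1) * (2 * (B + d) * \<epsilon> k)"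
      "n * n * (- inner (Q k) (e k)) \<le> n * n * (2 * (B + d) * \<epsilon> k)"
      using n by (intro mult_left_mono; simp)+
    \<comment> \<open>The two error weights add up to \<open>n * (2 * n + 1)\<close>, that is
      \<open>(real k + 1) * (2 * real k + 3)\<close>.\<close>
    ultimately have "(n + 1) * n / 2 * inner (Q (Suc k)) (Q (Suc k)) + (n + 1) * inner (Q (Suc k)) b
      \<le> n * (n - 1) / 2 * inner (Q k) (Q k) + n * inner (Q k) a
        + n * (n + 1) * (2 * (B + d) * \<epsilon> k) + n * n * (2 * (B + d) * \<epsilon> k)"
      by linarith
    then show ?thesis
      by (simp add: E_def n_def a_def b_def power2_norm_eq_inner algebra_simps)
  qed
  define R where "R = 2 * (B + d) * (\<Sum>j<k. (real j + 1) * (2 * real j + 3) * \<epsilon> j)"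
  have "E k \<le> 2 * (B + d) * (\<Sum>j<k. (real j + 1) * (2 * real j + 3) * \<epsilon> j)" for k
  proof (induction k)
    case (Suc k)
    then show ?case
      using E_step[of k] by (simp add: algebra_simps)
  qed (simp add: E_def)
  then have "E k \<le> R"
    by (simp add: R_def)
  \<comment> \<open>Splitting \<open>z k - z 0\<close> at \<open>p\<close>, cocoercivity adds half a
    squared residual, which raises the coefficient \<open>k (k + 1) / 2\<close> to
    \<open>(k + 1)\<^sup>2 / 2\<close>; Cauchy-Schwarz yields the linear term.\<close>
  moreover have "((real k + 1) * norm (Q k))\<^sup>2 / 2 - d * ((real k + 1) * norm (Q k)) \<le> E k"
  proof -
    have "(norm (Q k))\<^sup>2 / 2 \<le> inner (Q k) (z k - p)"
      using cocoercive[of "z k" p] by (simp add: Q_def p)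
    moreover have "- (norm (Q k) * d) \<le> inner (Q k) (p - z 0)"
      using Cauchy_Schwarz_ineq2[of "Q k" "p - z 0"] by (simp add: d_def norm_minus_commute abs_le_iff)
    moreover have "inner (Q k) (z k - z 0) = inner (Q k) (z k - p) + inner (Q k) (p - z 0)"
      by (simp add: inner_diff_right)
    ultimately have "(norm (Q k))\<^sup>2 / 2 - norm (Q k) * d \<le> inner (Q k) (z k - z 0)"
      by linarith
    then have "(real k + 1) * ((norm (Q k))\<^sup>2 / 2 - norm (Q k) * d) \<le> (real k + 1) * inner (Q k) (z k - z 0)"
      by (intro mult_left_mono) auto
    then show ?thesis
      by (simp add: E_def power_mult_distrib power2_eq_square field_simps)
  qed
  moreover have "R \<ge> 0"
    unfolding R_def using eps order_trans[OF norm_ge_zero Q]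
    by (intro mult_nonneg_nonneg sum_nonneg) auto
  moreover have "d \<ge> 0"
    by (simp add: d_def)
  ultimately have "(real k + 1) * norm (Q k) \<le> 2 * d + sqrt (2 * R)"
    by (intro le_of_quadratic) auto
  then show ?thesis
    by (simp add: R_def Q_def field_simps)
qed

section \<open>Sums of powers\<close>

text \<open>Mean value theorem, with \<open>t powr (s - 1)\<close> nonincreasing because
  \<open>s \<le> 1\<close>. Dividing by \<open>s\<close> treats positive and negative exponents
  together.\<close>

lemma powr_diff_ge:
  fixes s x :: real
  assumes s: "s \<noteq> 0" "s \<le> 1" and x: "x > 0"
  shows "(x + 1) powr (s - 1) \<le> ((x + 1) powr s - x powr s) / s"
proof -
  have "\<exists>t. t > x \<and> t < x + 1 \<and> (x + 1) powr s - x powr s = (x + 1 - x) * (s * t powr (s - 1))"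
    using x by (intro MVT2) (auto intro!: derivative_eq_intros simp: field_simps powr_diff)
  then obtain t where t: "x < t" "t < x + 1" "(x + 1) powr s - x powr s = s * t powr (s - 1)"
    by auto
  have "(x + 1) powr (s - 1) \<le> t powr (s - 1)"
    using t x s by (intro powr_mono2') auto
  then show ?thesis
    using t s by simp
qed

text \<open>Telescopes the preceding estimate; the right-hand side is the integral of
  \<open>t powr (s - 1)\<close> from 1 to \<open>real k + 1\<close>. Applied with
  \<open>s = 2 - \<delta>\<close>.\<close>

lemma sum_powr_le_integral:
  fixes s :: real
  assumes "s \<noteq> 0" "s \<le> 1"
  shows "(\<Sum>j<k. (real j + 2) powr (s - 1)) \<le> ((real k + 1) powr s - 1) / s"
proof (induction k)
  case (Suc k)
  show ?case
    using Suc powr_diff_ge[OF assms, of "real k + 1"] by (simp add: diff_divide_distrib add.commute)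
qed simp

text \<open>The logarithmic case \<open>s = 0\<close> of the integral comparison, for
  \<open>\<delta> = 2\<close>.\<close>

lemma sum_inverse_le_ln: "(\<Sum>j<k. 1 / (real j + 2)) \<le> ln (real k + 1)"
proof (induction k)
  case (Suc k)
  have "ln ((real k + 1) / (real k + 2)) \<le> (real k + 1) / (real k + 2) - 1"
    by (intro ln_le_minus_one) auto
  then have "1 / (real k + 2) \<le> ln (real k + 2) - ln (real k + 1)"
    by (simp add: ln_div field_simps)
  with Suc show ?case by (simp add: add.commute)
qed simp

text \<open>The summands increase, so each is at most the last one; serves
  \<open>\<delta> < 1\<close>.\<close>

lemma sum_powr_le_top:
  fixes a :: real
  assumes "a \<ge> 0"
  shows "(\<Sum>j<k. (real j + 2) powr a) \<le> (real k + 1) powr (a + 1)"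
proof -
  have "(\<Sum>j<k. (real j + 2) powr a) \<le> (\<Sum>j<k. (real k + 1) powr a)"
    using assms by (intro sum_mono powr_mono2) auto
  also have "\<dots> \<le> (real k + 1) * (real k + 1) powr a"
    by (simp add: mult_right_mono)
  finally show ?thesis by (simp add: powr_add mult.commute)
qed

section \<open>The convergence rates\<close>

theorem theorem3p1:
  fixes T :: "'a::{real_inner, complete_space} \<Rightarrow> 'a set"
    and zstar :: 'a and z :: "nat \<Rightarrow> 'a"
    and c \<delta> \<beta>0 \<kappa>0 :: real and \<Theta> :: "nat \<Rightarrow> real" and k :: nat
  assumes "maximal_monotone T"
    and "zstar \<in> zeros T"
    and "\<delta> > 0"
    and "c > 0"
    and "halpern_ippa T (\<lambda>_. c) (\<lambda>j. 1 / (real j + 2) powr (1 + \<delta>)) z"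
    and "\<beta>0 = (\<Sum>j. 1 / (real j + 2) powr (1 + \<delta>))"
    and "\<kappa>0 = 2 * (\<beta>0 + norm (z 0 - zstar))"
    and "\<And>k. 0 < \<delta> \<Longrightarrow> \<delta> < 1 \<Longrightarrow> \<Theta> k =
           8 * \<kappa>0 * \<beta>0 / (real k + 1) ^ 2
           + 4 * \<kappa>0 / (real k + 1) powr (2 + \<delta>)
           + (4 * \<kappa>0 * (3 - \<delta>) / (1 - \<delta>)) * (1 / (real k + 1) powr (1 + \<delta>))
           + (8 * \<kappa>0 / (2 - \<delta>)) * (1 / (real k + 1) powr \<delta>)"
    and "\<And>k. \<delta> = 1 \<Longrightarrow> \<Theta> k =
           4 * \<kappa>0 * (1 + 2 * \<beta>0) / (real k + 1) ^ 2
           + 4 * \<kappa>0 / (real k + 1) ^ 3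
           + 8 * \<kappa>0 * (ln (real k + 1) / (real k + 1) ^ 2)
           + 8 * \<kappa>0 / (real k + 1)"
    and "\<And>k. 1 < \<delta> \<Longrightarrow> \<delta> < 2 \<Longrightarrow> \<Theta> k =
           8 * \<kappa>0 * (1 / (\<delta> - 1) + \<beta>0) * (1 / (real k + 1) ^ 2)
           + 4 * \<kappa>0 / (real k + 1) powr (2 + \<delta>)
           + 4 * \<kappa>0 / (real k + 1) powr (1 + \<delta>)
           + (8 * \<kappa>0 / (2 - \<delta>)) * (1 / (real k + 1) powr \<delta>)"
    and "\<And>k. \<delta> = 2 \<Longrightarrow> \<Theta> k =
           8 * \<kappa>0 * (1 + \<beta>0) / (real k + 1) ^ 2
           + 4 * \<kappa>0 / (real k + 1) ^ 4
           + 4 * \<kappa>0 / (real k + 1) ^ 3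
           + 8 * \<kappa>0 * (ln (real k + 1) / (real k + 1) ^ 2)"
    and "\<And>k. \<delta> > 2 \<Longrightarrow> \<Theta> k =
           8 * \<kappa>0 * (1 / (\<delta> - 1) + 1 / (\<delta> - 2) + \<beta>0) * (1 / (real k + 1) ^ 2)
           + 4 * \<kappa>0 / (real k + 1) powr (2 + \<delta>)
           + 4 * \<kappa>0 / (real k + 1) powr (1 + \<delta>)"
    and "k \<ge> 1"
  shows "norm (z k - prox c T (z k)) \<le> 2 * norm (z 0 - zstar) / (real k + 1) + sqrt (\<Theta> k)"
proof -
  define d where "d = norm (z 0 - zstar)"
  define \<epsilon> where "\<epsilon> = (\<lambda>j. 1 / (real j + 2) powr (1 + \<delta>))"
  define N where "N = real k + 1"
  define V where "V = (\<Sum>j<k. (real j + 2) powr (1 - \<delta>))"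
  have mon: "monotone_operator T"
    using assms(1) by (simp add: maximal_monotone_def)
  obtain zbar where crit: "criterion_A T (\<lambda>_. c) \<epsilon> z zbar"
    and step: "\<And>k. z (Suc k) = (1 / (real k + 2)) *\<^sub>R z 0 + ((real k + 1) / (real k + 2)) *\<^sub>R zbar k"
    using assms(5) unfolding halpern_ippa_def \<epsilon>_def by blast
  have eps: "\<epsilon> k \<ge> 0" for k by (simp add: \<epsilon>_def)
  have summ: "summable \<epsilon>" and err: "\<And>k. norm (zbar k - prox c T (z k)) \<le> \<epsilon> k"
    using crit by (auto simp: criterion_A_def)
  have B: "sum \<epsilon> {..<n} \<le> \<beta>0" for n
    using sum_le_suminf[OF summ, of "{..<n}"] eps assms(6) by (simp add: \<epsilon>_def)
  have \<beta>: "\<beta>0 \<ge> 0" using B[of 0] by simp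
  then have \<kappa>: "\<kappa>0 \<ge> 0" using assms(7) by simp
  have N: "N \<ge> 1" by (simp add: N_def)
  have bound: "norm (z k - prox c T (z k)) \<le> (2 * d
    + sqrt (4 * (\<beta>0 + d) * (\<Sum>j<k. (real j + 1) * (2 * real j + 3) * \<epsilon> j))) / N"
    unfolding d_def N_def
  proof (rule halpern_residual_bound[OF _ prox_zero[OF mon assms(4,2)] err step B])
    show "norm (prox c T x - prox c T y) \<le> norm (x - y)" for x y
      using resolvent_nonexpansive[OF mon assms(4)] prox_in_resolvent[OF assms(1,4)] by blast
  qed
  have term_le: "(real j + 1) * (2 * real j + 3) * \<epsilon> j \<le> 2 * (real j + 2) powr (1 - \<delta>)" for j
  proof -
    have "(real j + 1) * (2 * real j + 3) \<le> 2 * (real j + 2)\<^sup>2"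
      by (simp add: power2_eq_square algebra_simps)
    then have "(real j + 1) * (2 * real j + 3) * \<epsilon> j \<le> 2 * (real j + 2)\<^sup>2 * \<epsilon> j"
      using eps by (intro mult_right_mono)
    also have "\<dots> = 2 * ((real j + 2) powr 2 / (real j + 2) powr (1 + \<delta>))"
      by (simp add: \<epsilon>_def)
    also have "\<dots> = 2 * (real j + 2) powr (1 - \<delta>)"
      using powr_diff[of "real j + 2" 2 "1 + \<delta>"] by simp
    finally show ?thesis .
  qed
  have "4 * (\<beta>0 + d) * (\<Sum>j<k. (real j + 1) * (2 * real j + 3) * \<epsilon> j) \<le> 4 * \<kappa>0 * V"
  proof -
    have "(\<Sum>j<k. (real j + 1) * (2 * real j + 3) * \<epsilon> j) \<le> 2 * V"
      unfolding V_def sum_distrib_left by (intro sum_mono term_le)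
    then have "2 * \<kappa>0 * (\<Sum>j<k. (real j + 1) * (2 * real j + 3) * \<epsilon> j) \<le> 2 * \<kappa>0 * (2 * V)"
      using \<kappa> by (intro mult_left_mono) auto
    then show ?thesis by (simp add: assms(7) d_def algebra_simps)
  qed
  \<comment> \<open>In every case a single term of \<open>\<Theta> k\<close> already dominates, and
    the others are nonnegative. The factor \<open>N\<^sup>2\<close> leaves the root as
    \<open>N\<close> and cancels the denominator of the residual bound.\<close>
  also have "4 * \<kappa>0 * V \<le> N\<^sup>2 * \<Theta> k"
  proof -
    have sq: "N\<^sup>2 = N powr 2" using N by simp
    have mul: "N\<^sup>2 * (a * (1 / N powr \<delta>)) = a * N powr (2 - \<delta>)" for a
      using N unfolding sq by (simp add: powr_diff)
    consider "\<delta> < 1" | "\<delta> = 1" | "1 < \<delta>" "\<delta> < 2" | "\<delta> = 2" | "\<delta> > 2" by linarith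
    then show ?thesis
    proof cases
      case 1
      have "V \<le> N powr (2 - \<delta>)"
        using sum_powr_le_top[of "1 - \<delta>" k] 1 by (simp add: V_def N_def)
      then have "4 * \<kappa>0 * V \<le> 4 * \<kappa>0 * N powr (2 - \<delta>)"
        using \<kappa> by (intro mult_left_mono) auto
      \<comment> \<open>Here \<open>4 \<le> 8 / (2 - \<delta>)\<close>, since
        \<open>0 < 2 - \<delta> < 2\<close>.\<close>
      also have "\<dots> \<le> 8 * \<kappa>0 / (2 - \<delta>) * N powr (2 - \<delta>)"
        using 1 \<kappa> assms(3) by (intro mult_right_mono) (auto simp: field_simps mult_left_mono)
      also have "\<dots> = N\<^sup>2 * (8 * \<kappa>0 / (2 - \<delta>) * (1 / N powr \<delta>))"
        by (rule mul[symmetric])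
      also have "\<dots> \<le> N\<^sup>2 * \<Theta> k"
        unfolding assms(8)[OF assms(3) 1] N_def[symmetric]
        using 1 \<kappa> \<beta> N by (intro mult_left_mono) auto
      finally show ?thesis .
    next
      case 2
      have "V \<le> N"
        by (simp add: V_def N_def 2)
      then have "4 * \<kappa>0 * V \<le> 8 * \<kappa>0 * N"
        using \<kappa> N by (intro mult_mono) (auto simp: V_def sum_nonneg)
      also have "\<dots> = N\<^sup>2 * (8 * \<kappa>0 / N)"
        using N by (simp add: power2_eq_square)
      also have "\<dots> \<le> N\<^sup>2 * \<Theta> k"
        unfolding assms(9)[OF 2] N_def[symmetric]
        using \<kappa> \<beta> N by (intro mult_left_mono) auto
      finally show ?thesis .
    next
      case 3
      have "V \<le> (N powr (2 - \<delta>) - 1) / (2 - \<delta>)"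
        using sum_powr_le_integral[of "2 - \<delta>" k] 3 by (simp add: V_def N_def)
      also have "\<dots> \<le> N powr (2 - \<delta>) / (2 - \<delta>)"
        using 3 by (simp add: divide_right_mono)
      finally have "4 * \<kappa>0 * V \<le> 8 * \<kappa>0 * (N powr (2 - \<delta>) / (2 - \<delta>))"
        using \<kappa> 3 by (intro mult_mono) (auto simp: V_def sum_nonneg)
      also have "\<dots> = N\<^sup>2 * (8 * \<kappa>0 / (2 - \<delta>) * (1 / N powr \<delta>))"
        by (subst mul) simp
      also have "\<dots> \<le> N\<^sup>2 * \<Theta> k"
        unfolding assms(10)[OF 3] N_def[symmetric]
        using 3 \<kappa> \<beta> N by (intro mult_left_mono) auto
      finally show ?thesis .
    next
      case 4
      have "V \<le> ln N"
        using sum_inverse_le_ln[of k] by (simp add: V_def N_def 4 powr_minus_divide)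
      then have "4 * \<kappa>0 * V \<le> 8 * \<kappa>0 * ln N"
        using \<kappa> N by (intro mult_mono) (auto simp: V_def sum_nonneg)
      also have "\<dots> = N\<^sup>2 * (8 * \<kappa>0 * (ln N / N\<^sup>2))"
        using N by simp
      also have "\<dots> \<le> N\<^sup>2 * \<Theta> k"
        unfolding assms(11)[OF 4] N_def[symmetric]
        using \<kappa> \<beta> N by (intro mult_left_mono) auto
      finally show ?thesis .
    next
      case 5
      have "V \<le> (N powr (2 - \<delta>) - 1) / (2 - \<delta>)"
        using sum_powr_le_integral[of "2 - \<delta>" k] 5 by (simp add: V_def N_def)
      \<comment> \<open>The denominator \<open>2 - \<delta>\<close> is negative, so changing both
        signs leaves \<open>1 - N powr (2 - \<delta>)\<close> on top, which is at most 1.\<close>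
      also have "\<dots> \<le> 1 / (\<delta> - 2)"
        using 5 N by (simp add: field_simps)
      also have "\<dots> \<le> 1 / (\<delta> - 1) + 1 / (\<delta> - 2) + \<beta>0"
        using 5 \<beta> by simp
      finally have "4 * \<kappa>0 * V \<le> 8 * \<kappa>0 * (1 / (\<delta> - 1) + 1 / (\<delta> - 2) + \<beta>0)"
        using \<kappa> by (intro mult_mono) (auto simp: V_def sum_nonneg)
      also have "\<dots> = N\<^sup>2 * (8 * \<kappa>0 * (1 / (\<delta> - 1) + 1 / (\<delta> - 2) + \<beta>0) * (1 / N\<^sup>2))"
        using N by simp
      also have "\<dots> \<le> N\<^sup>2 * \<Theta> k"
        unfolding assms(12)[OF 5] N_def[symmetric]
        using 5 \<kappa> \<beta> N by (intro mult_left_mono) auto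
      finally show ?thesis .
    qed
  qed
  finally have "sqrt (4 * (\<beta>0 + d) * (\<Sum>j<k. (real j + 1) * (2 * real j + 3) * \<epsilon> j)) \<le> N * sqrt (\<Theta> k)"
    using N by (auto dest: real_sqrt_le_mono simp: real_sqrt_mult)
  then have "(2 * d + sqrt (4 * (\<beta>0 + d) * (\<Sum>j<k. (real j + 1) * (2 * real j + 3) * \<epsilon> j))) / N
      \<le> (2 * d + N * sqrt (\<Theta> k)) / N"
    using N by (intro divide_right_mono) auto
  also have "\<dots> = 2 * d / N + sqrt (\<Theta> k)"
    using N by (simp add: add_divide_distrib)
  finally show ?thesis
    using bound by (simp add: d_def N_def)
qed

end
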